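(* Let $D=\{x\in\mathbf{R}^2:\|x\|\le 1\}$ be the closed unit disk. Let $\gamma\colon[0,\infty)\to\mathbf{R}^2$ be any path (in the sense defined in the context), and let $\ell\colon[0,\infty)\to\mathbf{R}^2$ be a straight line path, $\ell(s)=su$ for a fixed unit vector $u\in\mathbf{R}^2$. Let $X$ be a random variable uniformly distributed in $D$. Then the expected escape times satisfy \[ J(\gamma)\ge J(\ell), \] where for a path $\eta$ we set $J(\eta)=\mathbb{E}[T_\eta(X)]$ and $T_\eta(x)=\inf\{t\ge 0: x+\eta(t)\notin \operatorname{int}(D)\}$ (with $\inf\emptyset=\infty$).
   Context: $\|\cdot\|$ is the Euclidean norm. A path is a continuous curve $\gamma\colon[0,\infty)\to\mathbf{R}^2$ with $\gamma(0)=0$ that is arc-length parametrised: for every $t>0$, the length of the curve from $\gamma(0)$ to $\gamma(t)$ is exactly $t$ (corners are allowed, e.g. polygonal chains). The escape time $T_\gamma(x)$ from a starting point $x\in D$ is the first time $t\ge0$ at which $x+\gamma(t)$ leaves the interior of $D$, defined to be $\infty$ if this never happens. The expected escape time is $J(\gamma)=\mathbb{E}[T_\gamma(X)]$ with $X$ uniform in $D$. *)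

theory Defs
  imports "HOL-Analysis.Analysis"
begin

definition curve_length :: "(real \<Rightarrow> 'a::metric_space) \<Rightarrow> real \<Rightarrow> real \<Rightarrow> ereal" where
  "curve_length g a b =
     (SUP (n, s) \<in> {(n, s). s 0 = a \<and> s n = b \<and> (\<forall>i<n. s i \<le> s (Suc i))}.
        ereal (\<Sum>i<n. dist (g (s i)) (g (s (Suc i)))))"

definition arclength_path :: "(real \<Rightarrow> real^2) \<Rightarrow> bool" where
  "arclength_path g \<longleftrightarrow> continuous_on {0..} g \<and> g 0 = 0 \<and>
     (\<forall>t>0. curve_length g 0 t = ereal t)"

definition unit_disk :: "(real^2) set" where
  "unit_disk = cball 0 1"

definition escape_time :: "(real \<Rightarrow> real^2) \<Rightarrow> real^2 \<Rightarrow> ennreal" where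
  "escape_time g x = Inf {ennreal t | t. t \<ge> 0 \<and> x + g t \<notin> interior unit_disk}"

definition expected_escape :: "(real \<Rightarrow> real^2) \<Rightarrow> ennreal" where
  "expected_escape g = (\<integral>\<^sup>+ x. escape_time g x \<partial>(uniform_measure lborel unit_disk))"

end

theory Submission
  imports Defs
begin

text \<open>
  The point \<open>x\<close> has not escaped before time \<open>t\<close> iff it lies in the open unit disks around all
  \<open>- \<gamma> s\<close> with \<open>s < t\<close>. By the layer cake formula it suffices to compare, for each \<open>t\<close>, the areas
  of these intersections of disks; for the line the area is that of a lens \<open>L(t)\<close>, the intersection
  of two unit disks at distance \<open>t\<close>, and \<open>- L'(t)\<close> is the chord \<open>\<surd>(4 - t\<^sup>2)\<close> joining the corners of
  the lens.
  For a general path, let \<open>S\<close> be the current intersection and \<open>\<delta>\<close> its diameter. Moving the centre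
  by \<open>d\<close> removes area at most \<open>d \<delta>\<close> (slice parallel to the motion). On the other hand \<open>S\<close> contains
  the lens with chord \<open>\<delta>\<close> spanned by a diameter. So the area of \<open>S\<close> satisfies the differential
  inequality for which \<open>L\<close> is the extremal solution.
\<close>


section \<open>Isometric frames of the plane\<close>

lemma vector_2_eq_axis: "(vector [x, y] :: real^2) = x *\<^sub>R axis 1 1 + y *\<^sub>R axis 2 1"
  by (simp add: vec_eq_iff forall_2 axis_def)

text \<open>Carries Lebesgue measure from pairs, where slicing is available, to
  \<open>real^2\<close>; agreement on boxes determines the measure.\<close>

lemma lborel_distr_vec2:
  "distr lborel borel (\<lambda>(x, y). vector [x, y] :: real^2) = lborel"
proof (rule lborel_eqI[symmetric])
  have [measurable]: "(\<lambda>(x, y). vector [x, y] :: real^2) \<in> borel_measurable borel"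
    by (intro borel_measurable_continuous_onI)
      (auto simp: case_prod_unfold vector_2_eq_axis intro!: continuous_intros)
  fix l u :: "real^2"
  assume "\<And>b. b \<in> Basis \<Longrightarrow> l \<bullet> b \<le> u \<bullet> b"
  from this[of "axis i 1" for i] have le: "l $ i \<le> u $ i" for i
    by (auto simp: inner_axis)
  have "(\<lambda>(x, y). vector [x, y] :: real^2) -` box l u = box (l$1) (u$1) \<times> box (l$2) (u$2)"
    by (auto simp: mem_box_cart forall_2)
  then have "emeasure (distr lborel borel (\<lambda>(x, y). vector [x, y] :: real^2)) (box l u)
      = emeasure (lborel \<Otimes>\<^sub>M lborel) (box (l$1) (u$1) \<times> box (l$2) (u$2))"
    by (subst emeasure_distr) (auto simp: lborel_prod)
  also have "\<dots> = ennreal ((u$1 - l$1) * (u$2 - l$2))"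
    using le by (simp add: lborel.emeasure_pair_measure_Times ennreal_mult)
  also have "(u$1 - l$1) * (u$2 - l$2) = (\<Prod>b\<in>Basis. (u - l) \<bullet> b)"
    by (simp add: Basis_vec_def UNIV_2 inner_axis axis_eq_axis)
  finally show "emeasure (distr lborel borel (\<lambda>(x, y). vector [x, y] :: real^2)) (box l u)
      = ennreal (\<Prod>b\<in>Basis. (u - l) \<bullet> b)" .
qed simp

text \<open>The preimage is the image under the inverse map, again orthogonal, and
  \<open>lebesgue\<close> is invariant under such images; on Borel sets it agrees with
  \<open>lborel\<close>.\<close>

lemma emeasure_orthogonal_vimage:
  fixes f :: "real^2 \<Rightarrow> real^2"
  assumes f: "orthogonal_transformation f" and A: "A \<in> sets borel" "bounded A"
  shows "emeasure lborel (f -` A) = emeasure lborel A"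
proof -
  obtain g where g: "orthogonal_transformation g" "\<And>x. f (g x) = x" "\<And>x. g (f x) = x"
    using f orthogonal_transformation_bij orthogonal_transformation_inv
    by (metis bij_inv_eq_iff)
  have im: "g ` A = f -` A" using g by (auto simp: image_iff) (metis g(2,3))
  have "f \<in> borel_measurable borel"
    using f by (intro borel_measurable_continuous_onI linear_continuous_on)
      (simp add: linear_linear orthogonal_transformation_def)
  then have fA: "f -` A \<in> sets borel"
    using A measurable_sets[of f borel borel A] by simp
  have "A \<in> lmeasurable" using A by (intro bounded_set_imp_lmeasurable) auto
  moreover have "f -` A \<in> lmeasurable"
    using measurable_orthogonal_image[OF g(1) \<open>A \<in> lmeasurable\<close>] im by simp
  moreover have "measure lebesgue (f -` A) = measure lebesgue A"
    using measure_orthogonal_image[OF g(1) \<open>A \<in> lmeasurable\<close>] im by simp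
  moreover have "emeasure lborel X = ennreal (measure lebesgue X)"
    if "X \<in> sets borel" "X \<in> lmeasurable" for X :: "(real^2) set"
    using that emeasure_eq_measure2[OF that(2)] by simp
  ultimately show ?thesis
    using fA A by simp
qed

text \<open>Coordinates adapted to two points: an orthogonal map sends the first axis to the
  direction from \<open>c\<close> to \<open>c'\<close>, and a translation moves the origin to their
  midpoint. They serve both for two centres of disks and for the endpoints of a diameter.\<close>

lemma planar_frame:
  fixes c c' :: "real^2"
  assumes a: "dist c c' = 2 * a"
  obtains \<Phi> :: "real \<times> real \<Rightarrow> real^2" where
    "\<And>z w. dist (\<Phi> z) (\<Phi> w) = dist z w" "surj \<Phi>" "\<Phi> \<in> borel_measurable borel"
    "\<And>A. A \<in> sets borel \<Longrightarrow> bounded A \<Longrightarrow> emeasure lborel (\<Phi> -` A) = emeasure lborel A"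
    "\<Phi> (-a, 0) = c" "\<Phi> (a, 0) = c'"
proof -
  \<comment> \<open>For coinciding points \<open>a\<close> is 0 and any unit vector may serve as
    direction.\<close>
  define e where "e = (if c = c' then axis 1 1 else (c' - c) /\<^sub>R norm (c' - c))"
  have ne: "norm e = 1" by (simp add: e_def norm_axis_1)
  have a': "norm (c' - c) = 2 * a" using a by (simp add: dist_norm norm_minus_commute)
  have cc: "c' = c + (2*a) *\<^sub>R e"
  proof (cases "c = c'")
    case True
    then have "2 * a = 0" using a by simp
    then show ?thesis using True by simp
  next
    case False
    then have "(2*a) *\<^sub>R e = c' - c" unfolding a'[symmetric] e_def by simp
    then show ?thesis by simp
  qed
  obtain f :: "real^2 \<Rightarrow> real^2" where f: "orthogonal_transformation f" "f (axis 1 1) = e"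
    by (rule orthogonal_transformation_exists_1[OF norm_axis_1[of 1] ne])
  define v where "v = (\<lambda>(x, y). vector [x, y] :: real^2)"
  define t where "t = c + a *\<^sub>R e"
  define \<Phi> where "\<Phi> = (\<lambda>z. t + f (v z))"
  have lin: "linear f" using f by (simp add: orthogonal_transformation_def)
  have v: "v (x, y) = x *\<^sub>R axis 1 1 + y *\<^sub>R axis 2 1" for x y
    by (simp add: v_def vector_2_eq_axis)
  have fcont: "continuous_on UNIV f" using lin by (simp add: linear_continuous_on linear_linear)
  have vcont: "continuous_on UNIV v"
    unfolding v_def case_prod_unfold
    by (auto intro!: continuous_intros simp: vector_2_eq_axis)
  have 1: "dist (\<Phi> z) (\<Phi> w) = dist z w" for z w
  proof -
    have "dist (\<Phi> z) (\<Phi> w) = dist (v z) (v w)"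
      using f by (simp add: \<Phi>_def orthogonal_transformation_isometry)
    also have "\<dots> = dist z w"
      by (cases z; cases w) (simp add: v_def dist_norm norm_vec_def L2_set_def sum_2 norm_Pair)
    finally show ?thesis .
  qed
  have 2: "surj \<Phi>"
  proof -
    have "\<exists>z. \<Phi> z = x" for x
    proof -
      obtain y where y: "f y = x - t"
        using orthogonal_transformation_surj[OF f(1)] by (metis surjD)
      have "v (y$1, y$2) = y" by (simp add: v_def vec_eq_iff forall_2)
      then show ?thesis using y by (intro exI[of _ "(y$1, y$2)"]) (simp add: \<Phi>_def)
    qed
    then show ?thesis by (metis surjI)
  qed
  have cont: "continuous_on UNIV \<Phi>"
    unfolding \<Phi>_def by (intro continuous_intros continuous_on_compose2[OF fcont vcont]) auto
  have 4: "emeasure lborel (\<Phi> -` A) = emeasure lborel A" if A: "A \<in> sets borel" "bounded A" for A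
  proof -
    have tA: "(\<lambda>x. t + x) -` A \<in> sets borel"
      using A measurable_sets[of "\<lambda>x. t + x" borel borel A] by simp
    have eq: "(\<lambda>x. t + x) -` A = (\<lambda>x. - t + x) ` A" by force
    have bt: "bounded ((\<lambda>x. t + x) -` A)" unfolding eq by (rule bounded_translation[OF A(2)])
    have ftA: "f -` (\<lambda>x. t + x) -` A \<in> sets borel"
      using tA measurable_sets[OF borel_measurable_continuous_onI[OF fcont], of "(\<lambda>x. t + x) -` A"] by simp
    \<comment> \<open>The three factors of \<open>\<Phi>\<close> are removed one by one: change of
      type, orthogonal map, translation.\<close>
    have "emeasure lborel (\<Phi> -` A) = emeasure lborel (v -` f -` (\<lambda>x. t + x) -` A)"
      by (simp add: \<Phi>_def vimage_def)
    also have "\<dots> = emeasure lborel (f -` (\<lambda>x. t + x) -` A)"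
      using ftA borel_measurable_continuous_onI[OF vcont]
      by (subst lborel_distr_vec2[symmetric], subst emeasure_distr) (auto simp: v_def)
    also have "\<dots> = emeasure lborel ((\<lambda>x. t + x) -` A)"
      by (rule emeasure_orthogonal_vimage[OF f(1) tA bt])
    also have "\<dots> = emeasure lborel A"
      using A by (subst (2) lborel_distr_plus[symmetric, of t], subst emeasure_distr) auto
    finally show ?thesis .
  qed
  show thesis
  proof (rule that)
    have v0: "v (x, 0) = x *\<^sub>R axis 1 1" for x by (simp add: v)
    show "\<Phi> (-a, 0) = c"
      by (simp add: \<Phi>_def v0 linear_scale[OF lin] linear_neg[OF lin] f t_def)
    show "\<Phi> (a, 0) = c'"
      unfolding \<Phi>_def v0 linear_scale[OF lin] f t_def cc mult_2 scaleR_left.add by simp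
  qed (use 1 2 4 borel_measurable_continuous_onI[OF cont] in auto)
qed

section \<open>Lenses and crescents\<close>

text \<open>The argument of \<open>lens\<close> and \<open>lens_area\<close> is half the distance between the two centres.\<close>

definition lens :: "real \<Rightarrow> (real \<times> real) set" where
  "lens a = cball (-a, 0) 1 \<inter> cball (a, 0) 1"

definition lens_area :: "real \<Rightarrow> real" where
  "lens_area a = measure lborel (lens a)"

lemma mem_cball_Pair_0:
  fixes x y a :: real
  shows "(x, y) \<in> cball (a, 0) 1 \<longleftrightarrow> (x - a)\<^sup>2 + y\<^sup>2 \<le> 1"
  by (simp add: dist_Pair_Pair dist_real_def power2_commute)

lemma mem_lens: "(x, y) \<in> lens a \<longleftrightarrow> (x + a)\<^sup>2 + y\<^sup>2 \<le> 1 \<and> (x - a)\<^sup>2 + y\<^sup>2 \<le> 1"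
  unfolding lens_def Int_iff mem_cball_Pair_0 by simp

lemma emeasure_lborel_slices:
  fixes A :: "(real \<times> real) set"
  assumes "A \<in> sets borel"
  shows "emeasure lborel A = (\<integral>\<^sup>+y. emeasure lborel ((\<lambda>x. (x, y)) -` A) \<partial>lborel)"
proof -
  have "A \<in> sets (lborel \<Otimes>\<^sub>M lborel)" unfolding lborel_prod using assms by simp
  from lborel_pair.emeasure_pair_measure_alt2[OF this] show ?thesis by (simp only: lborel_prod)
qed

lemma lens_slice:
  assumes "0 \<le> a"
  shows "(\<lambda>x. (x, y)) -` lens a = {a - sqrt (1 - y\<^sup>2) .. sqrt (1 - y\<^sup>2) - a}"
proof (cases "y\<^sup>2 \<le> 1")
  case True
  have "(x - b)\<^sup>2 + y\<^sup>2 \<le> 1 \<longleftrightarrow> \<bar>x - b\<bar> \<le> sqrt (1 - y\<^sup>2)" for x b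
    using True by (simp add: real_sqrt_le_iff flip: real_sqrt_abs) linarith
  from this[of _ a] this[of _ "-a"] show ?thesis
    using assms by (auto simp: mem_lens)
next
  case False
  \<comment> \<open>HOL's \<open>sqrt\<close> is negative on negative arguments, so the interval is
    empty here, as is the slice.\<close>
  then have "sqrt (1 - y\<^sup>2) < 0" by simp
  moreover have "\<not> (x - b)\<^sup>2 + y\<^sup>2 \<le> 1" for x b
    using False zero_le_power2[of "x - b"] by linarith
  ultimately show ?thesis
    using assms by (auto simp: mem_lens simp del: real_sqrt_lt_0_iff)
qed

lemma lens_borel: "lens a \<in> sets borel"
  by (simp add: lens_def)

lemma emeasure_lens_finite: "emeasure lborel (lens a) < \<infinity>"
  by (intro emeasure_bounded_finite) (simp add: lens_def bounded_Int)

lemma emeasure_lens: "emeasure lborel (lens a) = ennreal (lens_area a)"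
  unfolding lens_area_def using emeasure_lens_finite[of a] by (intro emeasure_eq_ennreal_measure) auto

text \<open>A one-sided difference form of the derivative -4 sqrt (1 - a^2) of
  \<open>lens_area\<close>. Wherever the slice of \<open>lens b\<close> is nonempty, that of
  \<open>lens a\<close> is longer by 2 (b - a), and these heights form an interval of length 2 sqrt
  (1 - b^2).\<close>

lemma lens_area_strip:
  assumes "0 \<le> a" "a \<le> b" "b \<le> 1"
  shows "lens_area b + 4 * (b - a) * sqrt (1 - b\<^sup>2) \<le> lens_area a"
proof -
  define h where "h = sqrt (1 - b\<^sup>2)"
  have "b\<^sup>2 \<le> 1" using assms by (simp add: power_le_one)
  then have h: "0 \<le> h" by (simp add: h_def)
  have slice: "emeasure lborel ((\<lambda>x. (x, y)) -` lens b) + ennreal (2 * (b - a)) * indicator {-h..h} y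
      \<le> emeasure lborel ((\<lambda>x. (x, y)) -` lens a)" for y
  proof (cases "y \<in> {-h..h}")
    case True
    then have "y\<^sup>2 \<le> h\<^sup>2" using abs_le_square_iff[of y h] by auto
    then have "b\<^sup>2 \<le> 1 - y\<^sup>2" using \<open>b\<^sup>2 \<le> 1\<close> by (simp add: h_def)
    then have "b \<le> sqrt (1 - y\<^sup>2)" by (rule real_le_rsqrt)
    then show ?thesis
      using assms True by (simp add: lens_slice flip: ennreal_plus)
  next
    case False
    then show ?thesis
      using assms by (auto simp: lens_slice intro!: emeasure_mono)
  qed
  have "ennreal (lens_area b + 4 * (b - a) * h) = emeasure lborel (lens b) + ennreal (2 * (b - a)) * ennreal (2 * h)"
    using assms h by (simp add: emeasure_lens lens_area_def flip: ennreal_mult ennreal_plus)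
  also have "\<dots> = (\<integral>\<^sup>+y. emeasure lborel ((\<lambda>x. (x, y)) -` lens b) + ennreal (2 * (b - a)) * indicator {-h..h} y \<partial>lborel)"
    using h assms by (subst nn_integral_add)
      (auto simp: emeasure_lborel_slices lens_borel nn_integral_cmult_indicator lens_slice emeasure_lborel_Icc_eq)
  also have "\<dots> \<le> emeasure lborel (lens a)"
    unfolding emeasure_lborel_slices[OF lens_borel[of a]] by (intro nn_integral_mono slice)
  finally show ?thesis
    by (simp add: emeasure_lens lens_area_def h_def)
qed

lemma lens_area_antimono:
  assumes "0 \<le> a" "a \<le> b"
  shows "lens_area b \<le> lens_area a"
proof -
  have "lens b \<subseteq> lens a"
  proof (clarify)
    fix x y assume "(x, y) \<in> lens b"
    then have "x \<in> (\<lambda>x. (x, y)) -` lens b" by simp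
    then have "x \<in> (\<lambda>x. (x, y)) -` lens a" using assms by (simp add: lens_slice)
    then show "(x, y) \<in> lens a" by simp
  qed
  then show ?thesis
    unfolding lens_area_def using emeasure_lens_finite[of a] lens_borel[of a] lens_borel[of b]
    by (intro measure_mono_fmeasurable fmeasurableI) auto
qed

text \<open>The strip bound involves the chord at the far end \<open>a + d / 2\<close>; replacing it
  by the chord at \<open>a\<close> costs at most 2 d sqrt d. The error is not of order d^2 uniformly
  in \<open>a\<close>, because the slope of sqrt (1 - a^2) is unbounded near 1.\<close>

lemma lens_area_step:
  assumes "0 \<le> a" "0 \<le> d" "a + d / 2 \<le> 1"
  shows "lens_area (a + d / 2) - 2 * d * sqrt d \<le> lens_area a - 2 * d * sqrt (1 - a\<^sup>2)"
proof -
  let ?b = "a + d / 2"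
  have "?b\<^sup>2 \<le> 1" using assms by (simp add: power_le_one)
  have "1 - a\<^sup>2 = (1 - ?b\<^sup>2) + d * (a + d / 4)" by (simp add: power2_eq_square field_simps)
  also have "\<dots> \<le> (1 - ?b\<^sup>2) + d * 1" using assms by (intro add_left_mono mult_left_mono) auto
  finally have "sqrt (1 - a\<^sup>2) \<le> sqrt ((1 - ?b\<^sup>2) + d)" by simp
  also have "\<dots> \<le> sqrt (1 - ?b\<^sup>2) + sqrt d"
    using \<open>?b\<^sup>2 \<le> 1\<close> assms by (intro sqrt_add_le_add_sqrt) auto
  finally have "2 * d * sqrt (1 - a\<^sup>2) \<le> 2 * d * (sqrt (1 - ?b\<^sup>2) + sqrt d)"
    using assms by (intro mult_left_mono) auto
  moreover have "lens_area ?b + 4 * (?b - a) * sqrt (1 - ?b\<^sup>2) \<le> lens_area a"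
    using assms by (intro lens_area_strip) auto
  ultimately show ?thesis by (simp add: algebra_simps)
qed

text \<open>On a horizontal line the two disks cut out intervals that are translates of each other
  by 2 a, so the part of the first outside the second has length at most 2 a. Integrating over
  heights in a range of length \<open>w\<close> gives the bound.\<close>

lemma emeasure_crescent_le:
  fixes R :: "(real \<times> real) set"
  assumes "R \<in> sets borel" "0 \<le> a" "0 \<le> w"
    and R: "R \<subseteq> cball (-a, 0) 1 - cball (a, 0) 1"
    and y: "\<And>z. z \<in> R \<Longrightarrow> snd z \<in> {m..m + w}"
  shows "emeasure lborel R \<le> ennreal (2 * a * w)"
proof -
  have slice: "emeasure lborel ((\<lambda>x. (x, y)) -` R) \<le> ennreal (2 * a) * indicator {m..m + w} y" for y
  proof (cases "y \<in> {m..m+w}")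
    case True
    define r where "r = sqrt (1 - y\<^sup>2)"
    have "x \<in> {- a - r .. a - r}" if "(x, y) \<in> R" for x
    proof -
      have xy: "(x + a)\<^sup>2 + y\<^sup>2 \<le> 1" "\<not> (x - a)\<^sup>2 + y\<^sup>2 \<le> 1"
        using subsetD[OF R that] unfolding Diff_iff mem_cball_Pair_0 by simp_all
      have "\<bar>x + a\<bar> \<le> r" unfolding r_def using xy(1) by (intro real_le_rsqrt) simp
      moreover have "r < \<bar>x - a\<bar>" unfolding r_def using xy(2) by (intro real_less_lsqrt) auto
      ultimately show ?thesis using assms(2) by auto
    qed
    then have "emeasure lborel ((\<lambda>x. (x, y)) -` R) \<le> emeasure lborel {- a - r .. a - r}"
      by (intro emeasure_mono) auto
    then show ?thesis using True assms(2) by simp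
  next
    case False
    then have "(\<lambda>x. (x, y)) -` R = {}" using y by auto
    then show ?thesis by simp
  qed
  have "emeasure lborel R = (\<integral>\<^sup>+y. emeasure lborel ((\<lambda>x. (x, y)) -` R) \<partial>lborel)"
    by (rule emeasure_lborel_slices) fact
  also have "\<dots> \<le> (\<integral>\<^sup>+y. ennreal (2 * a) * indicator {m..m + w} y \<partial>lborel)"
    by (intro nn_integral_mono slice)
  also have "\<dots> = ennreal (2 * a * w)"
    using assms by (simp add: nn_integral_cmult_indicator ennreal_mult)
  finally show ?thesis .
qed

section \<open>Intersections of unit disks\<close>

lemma measure_cball_Int:
  fixes c c' :: "real^2"
  assumes "dist c c' = 2 * a"
  shows "measure lborel (cball c 1 \<inter> cball c' 1) = lens_area a"
proof -
  obtain \<Phi> :: "real \<times> real \<Rightarrow> real^2" where \<Phi>: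
    "\<And>z w. dist (\<Phi> z) (\<Phi> w) = dist z w" "surj \<Phi>"
    "\<And>A. A \<in> sets borel \<Longrightarrow> bounded A \<Longrightarrow> emeasure lborel (\<Phi> -` A) = emeasure lborel A"
    "\<Phi> (-a, 0) = c" "\<Phi> (a, 0) = c'"
    using planar_frame[OF assms] by metis
  have "\<Phi> -` (cball c 1 \<inter> cball c' 1) = lens a"
    by (auto simp: lens_def \<Phi>(1) simp flip: \<Phi>(4,5))
  then have "emeasure lborel (cball c 1 \<inter> cball c' 1) = emeasure lborel (lens a)"
    using \<Phi>(3)[of "cball c 1 \<inter> cball c' 1"] by (simp add: bounded_Int)
  then show ?thesis by (simp add: measure_def lens_area_def)
qed

text \<open>In coordinates whose first axis is the direction of motion, the removed part is a piece
  of a crescent, and its extent across the motion is at most the diameter bound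
  \<open>\<delta>\<close>.\<close>

lemma measure_Diff_cball_le:
  fixes c c' :: "real^2"
  assumes S: "S \<in> sets borel" "S \<subseteq> cball c 1" and "0 \<le> \<delta>"
    and diam: "\<And>p q. p \<in> S \<Longrightarrow> q \<in> S \<Longrightarrow> dist p q \<le> \<delta>"
  shows "measure lborel (S - cball c' 1) \<le> dist c c' * \<delta>"
proof -
  define a where "a = dist c c' / 2"
  obtain \<Phi> :: "real \<times> real \<Rightarrow> real^2" where \<Phi>:
    "\<And>z w. dist (\<Phi> z) (\<Phi> w) = dist z w" "\<Phi> \<in> borel_measurable borel"
    "\<And>A. A \<in> sets borel \<Longrightarrow> bounded A \<Longrightarrow> emeasure lborel (\<Phi> -` A) = emeasure lborel A"
    "\<Phi> (-a, 0) = c" "\<Phi> (a, 0) = c'"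
    using planar_frame[of c c' a] unfolding a_def by (metis field_sum_of_halves mult_2)
  define R where "R = \<Phi> -` (S - cball c' 1)"
  \<comment> \<open>The lowest height of the removed part; all other heights exceed it by at most
    \<open>\<delta>\<close>.\<close>
  define m where "m = Inf (snd ` R)"
  have diamR: "dist z w \<le> \<delta>" if "z \<in> R" "w \<in> R" for z w
    using diam[of "\<Phi> z" "\<Phi> w"] that by (simp add: R_def \<Phi>(1))
  have snd: "snd z \<le> snd w + \<delta>" if "z \<in> R" "w \<in> R" for z w
    using diamR[OF that] dist_snd_le[of z w] by (simp add: dist_real_def)
  have "snd z \<in> {m..m + \<delta>}" if z: "z \<in> R" for z
  proof -
    have "snd z - \<delta> \<le> snd w" if "w \<in> R" for w using snd[OF z that] by simp
    then have "snd z - \<delta> \<le> m" "m \<le> snd z"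
      unfolding m_def using z by (auto intro!: cINF_greatest cINF_lower bdd_belowI2[of _ "snd z - \<delta>"])
    then show ?thesis by simp
  qed
  moreover have "R \<subseteq> cball (-a, 0) 1 - cball (a, 0) 1"
    using S(2) by (auto simp: R_def \<Phi>(1) simp flip: \<Phi>(4,5))
  moreover have "R \<in> sets borel"
    unfolding R_def using S(1) measurable_sets[OF \<Phi>(2), of "S - cball c' 1"] by simp
  ultimately have "emeasure lborel R \<le> ennreal (2 * a * \<delta>)"
    using \<open>0 \<le> \<delta>\<close> by (intro emeasure_crescent_le[where m = m]) (auto simp: a_def)
  moreover have "bounded (S - cball c' 1)"
    using S(2) bounded_cball by (metis bounded_diff bounded_subset)
  ultimately have "emeasure lborel (S - cball c' 1) \<le> ennreal (2 * a * \<delta>)"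
    using \<Phi>(3)[of "S - cball c' 1"] S(1) by (simp add: R_def)
  then show ?thesis
    using \<open>0 \<le> \<delta>\<close> by (simp add: measure_def a_def enn2real_leI)
qed

text \<open>
  In coordinates, \<open>p = (-b, 0)\<close>, \<open>q = (b, 0)\<close> and the centres \<open>(0, -a)\<close>, \<open>(0, a)\<close> of the
  lens spanned by \<open>p\<close> and \<open>q\<close> form a unit rhombus. Taking absolute values of
  the coordinates of \<open>c\<close> and \<open>x\<close> and shifting gives points \<open>C\<close> and \<open>X\<close> of the unit disk in the first
  quadrant, on different sides of the unit vector \<open>m = (b, a)\<close>. Hence \<open>(X - m) \<bullet> (C - m) \<le> 0\<close> and \<open>|X + C - m|\<^sup>2 \<le> |X|\<^sup>2 + |C|\<^sup>2 - |m|\<^sup>2 \<le> 1\<close>.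
\<close>

lemma lens_subset_cball:
  fixes a b :: real and c x :: "real \<times> real"
  assumes "0 \<le> a" "0 \<le> b" and ab: "a\<^sup>2 + b\<^sup>2 = 1"
    and c: "dist (-b, 0) c \<le> 1" "dist (b, 0) c \<le> 1"
    and x: "dist (0, -a) x \<le> 1" "dist (0, a) x \<le> 1"
  shows "dist c x \<le> 1"
proof -
  obtain c1 c2 x1 x2 where cx: "c = (c1, c2)" "x = (x1, x2)" by (cases c; cases x)
  define C1 C2 X1 X2 where "C1 = \<bar>c1\<bar> + b" "C2 = \<bar>c2\<bar>" "X1 = \<bar>x1\<bar>" "X2 = \<bar>x2\<bar> + a"
  note defs = this
  have C: "C1\<^sup>2 + C2\<^sup>2 \<le> 1"
    using c by (cases "c1 \<ge> 0") (auto simp: defs cx dist_Pair_Pair dist_real_def power2_eq_square algebra_simps)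
  have X: "X1\<^sup>2 + X2\<^sup>2 \<le> 1"
    using x by (cases "x2 \<ge> 0") (auto simp: defs cx dist_Pair_Pair dist_real_def power2_eq_square algebra_simps)
  have nn: "b \<le> C1" "a \<le> X2" "0 \<le> C2" "0 \<le> X1" by (auto simp: defs)
  have "b\<^sup>2 \<le> C1\<^sup>2" "a\<^sup>2 \<le> X2\<^sup>2" using nn assms by (auto intro!: power_mono)
  then have "C2\<^sup>2 \<le> a\<^sup>2" "X1\<^sup>2 \<le> b\<^sup>2" using C X ab by auto
  then have "C2 \<le> a" "X1 \<le> b" using assms by (auto intro: power2_le_imp_le)
  then have obtuse: "(X1 - b) * (C1 - b) \<le> 0" "(X2 - a) * (C2 - a) \<le> 0"
    using nn by (simp_all add: mult_nonpos_nonneg mult_nonneg_nonpos)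
  have "(c1 - x1)\<^sup>2 + (c2 - x2)\<^sup>2 \<le> (X1 + C1 - b)\<^sup>2 + (X2 + C2 - a)\<^sup>2"
  proof (intro add_mono)
    have "\<bar>c1 - x1\<bar> \<le> \<bar>X1 + C1 - b\<bar>" "\<bar>c2 - x2\<bar> \<le> \<bar>X2 + C2 - a\<bar>" by (auto simp: defs)
    then show "(c1 - x1)\<^sup>2 \<le> (X1 + C1 - b)\<^sup>2" "(c2 - x2)\<^sup>2 \<le> (X2 + C2 - a)\<^sup>2"
      by (simp_all only: abs_le_square_iff)
  qed
  also have "\<dots> = (X1\<^sup>2 + X2\<^sup>2) + (C1\<^sup>2 + C2\<^sup>2) - (a\<^sup>2 + b\<^sup>2)
      + 2 * ((X1 - b) * (C1 - b) + (X2 - a) * (C2 - a))"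
    by (simp add: power2_eq_square algebra_simps)
  also have "\<dots> \<le> 1 + 1 - 1 + 2 * (0 + 0)"
    using C X ab obtuse by (intro add_mono diff_mono mult_left_mono) auto
  finally show ?thesis by (simp add: cx dist_Pair_Pair dist_real_def)
qed

text \<open>The lens with corners \<open>p\<close> and \<open>q\<close> depends on these two points
  only, so it lies in every intersection of unit disks that contains both.\<close>

lemma lens_spanned:
  fixes p q :: "real^2"
  assumes "0 \<le> a" "0 \<le> b" "a\<^sup>2 + b\<^sup>2 = 1" "dist p q = 2 * b"
  obtains z z' where "dist z z' = 2 * a"
    "\<And>c. p \<in> cball c 1 \<Longrightarrow> q \<in> cball c 1 \<Longrightarrow> cball z 1 \<inter> cball z' 1 \<subseteq> cball c 1"
proof -
  obtain \<Phi> :: "real \<times> real \<Rightarrow> real^2" where \<Phi>: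
    "\<And>z w. dist (\<Phi> z) (\<Phi> w) = dist z w" "surj \<Phi>" "\<Phi> (-b, 0) = p" "\<Phi> (b, 0) = q"
    using planar_frame[OF assms(4)] by metis
  show thesis
  proof (rule that[of "\<Phi> (0, -a)" "\<Phi> (0, a)"])
    show "dist (\<Phi> (0, -a)) (\<Phi> (0, a)) = 2 * a"
      using \<open>0 \<le> a\<close> by (simp add: \<Phi>(1) dist_Pair_Pair dist_real_def real_sqrt_mult)
    fix c
    assume c: "p \<in> cball c 1" "q \<in> cball c 1"
    obtain c0 where c0: "c = \<Phi> c0" using \<Phi>(2) by (metis surjD)
    show "cball (\<Phi> (0, -a)) 1 \<inter> cball (\<Phi> (0, a)) 1 \<subseteq> cball c 1"
    proof
      fix x assume x: "x \<in> cball (\<Phi> (0, -a)) 1 \<inter> cball (\<Phi> (0, a)) 1"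
      obtain x0 where x0: "x = \<Phi> x0" using \<Phi>(2) by (metis surjD)
      have "dist (-b, 0) c0 \<le> 1" "dist (b, 0) c0 \<le> 1"
        using c \<Phi>(1)[of "(-b, 0)" c0] \<Phi>(1)[of "(b, 0)" c0]
        by (simp_all add: \<Phi>(3,4) c0 dist_commute)
      moreover have "dist (0, -a) x0 \<le> 1" "dist (0, a) x0 \<le> 1"
        using x \<Phi>(1)[of "(0, -a)" x0] \<Phi>(1)[of "(0, a)" x0] by (simp_all add: x0)
      ultimately have "dist c0 x0 \<le> 1"
        by (rule lens_subset_cball[OF assms(1-3)])
      then show "x \<in> cball c 1" by (simp add: c0 x0 \<Phi>(1))
    qed
  qed
qed

text \<open>
  \<open>S\<close> contains a lens spanned by a diameter \<open>2 b\<close> of \<open>S\<close>, while moving a centre by \<open>d\<close> removes area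
  at most \<open>2 b d\<close>. The error term \<open>2 d \<surd>d\<close> stays summable to \<open>0\<close> over \<open>O(1/d)\<close> steps.
\<close>

lemma measure_Inter_cball_step:
  fixes C :: "(real^2) set"
  defines "S \<equiv> \<Inter>c\<in>C. cball c 1"
  assumes "c \<in> C" "dist c c' \<le> d" "0 \<le> x" "x + d / 2 \<le> 1" "0 \<le> e"
    and S: "lens_area x - e \<le> measure lborel S"
  shows "lens_area (x + d / 2) - (e + 2 * d * sqrt d) \<le> measure lborel (S \<inter> cball c' 1)"
proof -
  have d: "0 \<le> d" using assms zero_le_dist order_trans by blast
  show ?thesis
  proof (cases "S = {}")
    case True
    have "lens_area (x + d / 2) \<le> lens_area x" using assms d by (intro lens_area_antimono) auto
    moreover have "0 \<le> 2 * d * sqrt d" using d by simp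
    ultimately show ?thesis using True S by simp
  next
    case False
    have sub: "S \<subseteq> cball c 1" using assms by auto
    have "closed S" unfolding S_def by (intro closed_INT) auto
    then have comp: "compact S"
      using sub bounded_cball bounded_subset compact_eq_bounded_closed by blast
    have fin: "S \<in> fmeasurable lborel" by (rule fmeasurable_compact[OF comp])
    obtain p q where pq: "p \<in> S" "q \<in> S" "dist p q = diameter S"
      using diameter_compact_attained[OF comp False] by blast
    define b where "b = dist p q / 2"
    \<comment> \<open>Half the distance between the centres of the lens with corners
      \<open>p\<close> and \<open>q\<close>.\<close>
    define a where "a = sqrt (1 - b\<^sup>2)"
    have "dist c p \<le> 1" "dist c q \<le> 1" using sub pq(1,2) by auto
    then have "dist p q \<le> 2" using dist_triangle3[of p q c] by linarith
    then have b: "0 \<le> b" "b \<le> 1" by (auto simp: b_def)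
    then have "b\<^sup>2 \<le> 1" by (simp add: power_le_one)
    then have a: "0 \<le> a" "a\<^sup>2 + b\<^sup>2 = 1" "a \<le> 1" by (auto simp: a_def)
    have "1 - a\<^sup>2 = b\<^sup>2" using a by linarith
    then have b_eq: "b = sqrt (1 - a\<^sup>2)" using b by simp
    obtain z z' where z: "dist z z' = 2 * a"
      "\<And>c. p \<in> cball c 1 \<Longrightarrow> q \<in> cball c 1 \<Longrightarrow> cball z 1 \<inter> cball z' 1 \<subseteq> cball c 1"
      by (rule lens_spanned[OF a(1) b(1) a(2), of p q]) (simp_all add: b_def)
    have "lens_area a = measure lborel (cball z 1 \<inter> cball z' 1)"
      using measure_cball_Int[OF z(1)] by simp
    also have "\<dots> \<le> measure lborel S"
    proof (intro measure_mono_fmeasurable[OF _ _ fin])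
      show "cball z 1 \<inter> cball z' 1 \<subseteq> S"
        unfolding S_def using z(2) pq(1,2) by (intro INT_greatest) (auto simp: S_def)
    qed simp
    finally have lens_le: "lens_area a \<le> measure lborel S" .
    have "dist p' q' \<le> 2 * b" if "p' \<in> S" "q' \<in> S" for p' q'
      using diameter_bounded_bound[OF compact_imp_bounded[OF comp] that] pq(3) by (simp add: b_def)
    then have "measure lborel (S - cball c' 1) \<le> dist c c' * (2 * b)"
      using b sub \<open>closed S\<close> by (intro measure_Diff_cball_le) auto
    also have "\<dots> \<le> 2 * d * b" using assms b mult_right_mono[of "dist c c'" d "2 * b"] by simp
    also have "measure lborel (S - cball c' 1) = measure lborel S - measure lborel (S \<inter> cball c' 1)"
      using measurable_measure_Diff[OF fin, of "S \<inter> cball c' 1"] \<open>closed S\<close> by (simp add: Diff_Int)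
    finally have *: "measure lborel S - 2 * d * b \<le> measure lborel (S \<inter> cball c' 1)" by simp
    show ?thesis
    \<comment> \<open>If \<open>x \<le> a\<close>, the diameter of \<open>S\<close> is at most the
      chord of \<open>lens x\<close>, so \<open>S\<close> loses no more than the lens does, up to
      the error. Otherwise the lens inside \<open>S\<close> is the larger one, and the step is made
      from \<open>a\<close> in place of \<open>x\<close>.\<close>
    proof (cases "x \<le> a")
      case True
      then have "b \<le> sqrt (1 - x\<^sup>2)"
        unfolding b_eq using \<open>0 \<le> x\<close> by (simp add: power_mono)
      then have "2 * d * b \<le> 2 * d * sqrt (1 - x\<^sup>2)" using d by (intro mult_left_mono) auto
      moreover have "lens_area (x + d / 2) - 2 * d * sqrt d \<le> lens_area x - 2 * d * sqrt (1 - x\<^sup>2)"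
        using assms d by (intro lens_area_step) auto
      ultimately show ?thesis using * S by linarith
    next
      case False
      have "lens_area (a + d / 2) - 2 * d * sqrt d \<le> lens_area a - 2 * d * b"
        unfolding b_eq using a d False assms by (intro lens_area_step) auto
      moreover have "lens_area (x + d / 2) \<le> lens_area (a + d / 2)"
        using a d False by (intro lens_area_antimono) auto
      ultimately show ?thesis using * lens_le \<open>0 \<le> e\<close> by linarith
    qed
  qed
qed

text \<open>Iterates the single step from one full disk, which is the lens at distance 0; each new
  centre adds the same error, and \<open>n * d \<le> 2\<close> keeps the half distance at most
  1.\<close>

lemma measure_Inter_cball_chain:
  fixes c :: "nat \<Rightarrow> real^2"
  assumes "\<And>i. i < n \<Longrightarrow> dist (c i) (c (Suc i)) \<le> d" "0 \<le> d" "n * d \<le> 2"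
  shows "lens_area (n * d / 2) - n * (2 * d * sqrt d) \<le> measure lborel (\<Inter>i\<le>n. cball (c i) 1)"
  using assms
proof (induction n)
  case 0
  show ?case using measure_cball_Int[of "c 0" "c 0" 0] by simp
next
  case (Suc n)
  have eq: "(\<Inter>i\<le>Suc n. cball (c i) 1) = (\<Inter>z\<in>c ` {..n}. cball z 1) \<inter> cball (c (Suc n)) 1"
    by (auto simp: atMost_Suc)
  have "n * d \<le> 2" using Suc.prems by (simp add: algebra_simps)
  then have IH: "lens_area (n * d / 2) - n * (2 * d * sqrt d) \<le> measure lborel (\<Inter>z\<in>c ` {..n}. cball z 1)"
    using Suc by simp
  have "lens_area (n * d / 2 + d / 2) - (n * (2 * d * sqrt d) + 2 * d * sqrt d)
      \<le> measure lborel ((\<Inter>z\<in>c ` {..n}. cball z 1) \<inter> cball (c (Suc n)) 1)"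
    using Suc.prems by (intro measure_Inter_cball_step[where c = "c n"] IH) (auto simp: algebra_simps)
  then show ?case unfolding eq by (simp add: algebra_simps add_divide_distrib)
qed

section \<open>Escape times\<close>

text \<open>Appending \<open>t\<close> to a partition of [0, s] gives a partition of [0, t]; hence
  the length up to \<open>s\<close> plus the last chord is at most the length up to
  \<open>t\<close>.\<close>

lemma arclength_path_dist_le:
  assumes g: "arclength_path g" and "0 \<le> s" "s \<le> t"
  shows "dist (g s) (g t) \<le> t - s"
proof (cases "s = t")
  case False
  with assms have t: "0 < t" by simp
  define P where "P a b = {(n, p). p 0 = a \<and> p n = b \<and> (\<forall>i<n. p i \<le> p (Suc i))}"
    for a b :: real and n :: nat and p :: "nat \<Rightarrow> real"
  have len: "(\<Sum>i<n. dist (g (p i)) (g (p (Suc i)))) \<le> t" if "(n, p) \<in> P 0 t" for n p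
  proof -
    have "ereal (\<Sum>i<n. dist (g (p i)) (g (p (Suc i)))) \<le> curve_length g 0 t"
      unfolding curve_length_def using that by (intro SUP_upper2[of "(n, p)"]) (auto simp: P_def)
    then show ?thesis using g t by (simp add: arclength_path_def)
  qed
  have "s + dist (g s) (g t) \<le> t"
  \<comment> \<open>The length is prescribed for positive times only, so \<open>s = 0\<close> is
    handled by the one-step partition.\<close>
  proof (cases "s = 0")
    case True
    have "(1, \<lambda>i. if i = 0 then 0 else t) \<in> P 0 t" using t by (simp add: P_def)
    from len[OF this] show ?thesis using True by simp
  next
    case False
    have "curve_length g 0 s \<le> ereal (t - dist (g s) (g t))"
      unfolding curve_length_def
    proof (intro SUP_least, clarsimp)
      fix n and p :: "nat \<Rightarrow> real"
      assume p: "p 0 = 0" "s = p n" "\<forall>i<n. p i \<le> p (Suc i)"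
      let ?p = "\<lambda>i. if i \<le> n then p i else t"
      have "(Suc n, ?p) \<in> P 0 t" using p assms by (auto simp: P_def less_Suc_eq)
      from len[OF this]
      show "(\<Sum>i<n. dist (g (p i)) (g (p (Suc i)))) \<le> t - dist (g (p n)) (g t)"
        by simp
    qed
    then show ?thesis using g False assms by (simp add: arclength_path_def)
  qed
  then show ?thesis by simp
qed simp

text \<open>Sampling at 2^n equal steps of size d = t / 2^n accumulates the error 2 t sqrt d, which
  tends to 0. The dyadic grids are nested, so the sampled intersections decrease and continuity of
  measure from above applies.\<close>

lemma path_measure_Inter_cball:
  fixes g :: "real \<Rightarrow> real^2"
  assumes lip: "\<And>s s'. 0 \<le> s \<Longrightarrow> s \<le> s' \<Longrightarrow> dist (g s) (g s') \<le> s' - s"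
    and t: "0 \<le> t" "t \<le> 2"
  shows "lens_area (t / 2) \<le> measure lborel (\<Inter>s\<in>{0..t}. cball (- g s) 1)"
proof -
  define \<tau> where "\<tau> n i = real i * t / 2 ^ n" for n i :: nat
  define K where "K n = (\<Inter>i\<le>2^n. cball (- g (\<tau> n i)) 1)" for n
  have "lens_area (t / 2) - 2 * t * sqrt (t / 2 ^ n) \<le> measure lborel (K n)" for n
  proof -
    have "dist (- g (\<tau> n i)) (- g (\<tau> n (Suc i))) \<le> t / 2 ^ n" for i
      using lip[of "\<tau> n i" "\<tau> n (Suc i)"] t
      by (simp add: \<tau>_def dist_minus field_simps)
    from measure_Inter_cball_chain[of "2 ^ n" "\<lambda>i. - g (\<tau> n i)", OF this] t
    show ?thesis by (simp add: K_def)
  qed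
  moreover have "(\<lambda>n. lens_area (t / 2) - 2 * t * sqrt (t / 2 ^ n)) \<longlonglongrightarrow> lens_area (t / 2) - 2 * t * sqrt 0"
    by (intro tendsto_intros LIMSEQ_divide_realpow_zero) simp
  moreover have "(\<lambda>n. measure lborel (K n)) \<longlonglongrightarrow> measure lborel (\<Inter>n. K n)"
  proof (rule Lim_measure_decseq)
    show "range K \<subseteq> sets lborel"
      unfolding K_def by (auto intro!: borel_closed closed_INT)
    show "decseq K"
    proof (rule decseq_SucI)
      fix n
      have \<tau>: "\<tau> n i = \<tau> (Suc n) (2 * i)" for i by (simp add: \<tau>_def)
      show "K (Suc n) \<subseteq> K n"
        unfolding K_def \<tau> by (intro INF_mono) (auto intro!: bexI[of _ "2 * _"])
    qed
    show "emeasure lborel (K n) \<noteq> \<infinity>" for n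
    proof -
      have "bounded (K n)" unfolding K_def
        by (rule bounded_subset[OF bounded_cball, of _ "- g (\<tau> n 0)" 1]) auto
      then show ?thesis using emeasure_bounded_finite[of "K n"] by simp
    qed
  qed
  ultimately have "lens_area (t / 2) - 2 * t * sqrt 0 \<le> measure lborel (\<Inter>n. K n)"
    by (intro LIMSEQ_le) auto
  moreover have "(\<Inter>n. K n) = (\<Inter>s\<in>{0..t}. cball (- g s) 1)"
  proof
    have "\<tau> n i \<in> {0..t}" if "i \<le> 2 ^ n" for n i
    proof -
      have "real i \<le> 2 ^ n" using that by (metis of_nat_le_iff of_nat_numeral of_nat_power)
      then show ?thesis using t by (simp add: \<tau>_def field_simps mult_left_mono)
    qed
    then show "(\<Inter>s\<in>{0..t}. cball (- g s) 1) \<subseteq> (\<Inter>n. K n)"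
      unfolding K_def by fastforce
    show "(\<Inter>n. K n) \<subseteq> (\<Inter>s\<in>{0..t}. cball (- g s) 1)"
    proof (intro subsetI INT_I)
      fix x s assume x: "x \<in> (\<Inter>n. K n)" and s: "s \<in> {0..t}"
      \<comment> \<open>The last grid point up to \<open>s\<close> is within time
        \<open>t / 2 ^ n\<close>, so by the Lipschitz bound its disk misses the disk at
        \<open>s\<close> by at most that much; the loss vanishes in the limit.\<close>
      have "dist (- g s) x \<le> 1 + t / 2 ^ n" for n
      proof (cases "t = 0")
        case True
        then show ?thesis using x s by (auto simp: K_def \<tau>_def)
      next
        case False
        then have "0 < t" using t by simp
        define i where "i = nat \<lfloor>s / t * 2 ^ n\<rfloor>"
        have i: "real i \<le> s / t * 2 ^ n" "s / t * 2 ^ n < real i + 1"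
          using s \<open>0 < t\<close> unfolding i_def by (auto simp: of_nat_nat)
        have "s / t * 2 ^ n \<le> 1 * 2 ^ n" using s \<open>0 < t\<close> by (intro mult_right_mono) auto
        then have "real i \<le> 2 ^ n" using i(1) by linarith
        then have "i \<le> 2 ^ n" by simp
        then have "dist (- g (\<tau> n i)) x \<le> 1" using x by (auto simp: K_def)
        moreover have "\<tau> n i \<le> s" "s \<le> (t + t * real i) / 2 ^ n" "0 \<le> \<tau> n i"
          using i \<open>0 < t\<close> by (simp_all add: \<tau>_def field_simps)
        then have "\<tau> n i \<le> s" "s - \<tau> n i \<le> t / 2 ^ n" "0 \<le> \<tau> n i"
          by (simp_all add: \<tau>_def add_divide_distrib mult.commute)
        then have "dist (- g (\<tau> n i)) (- g s) \<le> t / 2 ^ n"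
          using lip[of "\<tau> n i" s] by (simp add: dist_minus)
        ultimately show ?thesis using dist_triangle3[of "- g s" x "- g (\<tau> n i)"] by linarith
      qed
      moreover have "(\<lambda>n. 1 + t / 2 ^ n) \<longlonglongrightarrow> 1 + 0"
        by (intro tendsto_intros LIMSEQ_divide_realpow_zero) simp
      ultimately have "dist (- g s) x \<le> 1 + 0" by (intro LIMSEQ_le_const) auto
      then show "x \<in> cball (- g s) 1" by simp
    qed
  qed
  ultimately show ?thesis by simp
qed

section \<open>Measurability of the escape time and the layer cake formula\<close>

text \<open>The bound \<open>s < t\<close> is strict because a path leaving exactly at
  \<open>t\<close> still has escape time \<open>t\<close>. This form needs no attainment of the
  infimum.\<close>

lemma le_escape_time_iff:
  "ennreal t \<le> escape_time g x \<longleftrightarrow> (\<forall>s. 0 \<le> s \<and> s < t \<longrightarrow> norm (x + g s) < 1)"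
proof -
  have "ennreal t \<le> escape_time g x \<longleftrightarrow> (\<forall>s\<ge>0. 1 \<le> norm (x + g s) \<longrightarrow> ennreal t \<le> ennreal s)"
    by (auto simp: escape_time_def unit_disk_def interior_cball le_Inf_iff not_less)
  also have "\<dots> \<longleftrightarrow> (\<forall>s. 0 \<le> s \<and> s < t \<longrightarrow> norm (x + g s) < 1)"
    by (auto simp: ennreal_le_iff not_less not_le)
  finally show ?thesis .
qed

lemma escape_time_measurable:
  assumes "continuous_on {0..} g"
  shows "escape_time g \<in> borel_measurable borel"
proof (rule borel_measurableI_ge)
  fix y :: ennreal
  have "{x. \<forall>s. 0 \<le> s \<and> s < t \<longrightarrow> norm (x + g s) < 1} \<in> sets borel" for t
  proof -
    \<comment> \<open>Escape at some time up to \<open>t - 1 / Suc n\<close>: the sum of a compact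
      and a closed set, hence closed. The shifted end points exhaust the times before
      \<open>t\<close>.\<close>
    define E where "E n = (\<Union>s\<in>{0..t - 1 / Suc n}. \<Union>z\<in>- ball 0 1. {z - g s})" for n :: nat
    have E: "E n \<in> sets borel" for n
    proof -
      have "compact ((\<lambda>s. - g s) ` {0..t - 1 / Suc n})"
        by (intro compact_continuous_image continuous_on_minus continuous_on_subset[OF assms]) auto
      from compact_closed_sums[OF this, of "- ball 0 1"] have "closed (E n)"
        by (rule back_subst[of closed]) (auto simp: E_def algebra_simps)
      then show ?thesis by (rule borel_closed)
    qed
    have "{x. \<forall>s. 0 \<le> s \<and> s < t \<longrightarrow> norm (x + g s) < 1} = - (\<Union>n. E n)"
    proof (intro set_eqI iffI)
      fix x assume "x \<in> {x. \<forall>s. 0 \<le> s \<and> s < t \<longrightarrow> norm (x + g s) < 1}"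
      moreover have "s < t" if "s \<le> t - 1 / Suc n" for s n
        using that by (smt (verit) divide_pos_pos of_nat_0_less_iff zero_less_Suc)
      ultimately show "x \<in> - (\<Union>n. E n)" by (auto simp: E_def) force
    next
      fix x assume x: "x \<in> - (\<Union>n. E n)"
      have "norm (x + g s) < 1" if s: "0 \<le> s" "s < t" for s
      proof (rule ccontr)
        assume "\<not> norm (x + g s) < 1"
        obtain n where "1 / Suc n < t - s" using s nat_approx_posE[of "t - s"] by auto
        then have "x \<in> E n"
          unfolding E_def using \<open>\<not> norm (x + g s) < 1\<close> s
          by (intro UN_I[of s] UN_I[of "x + g s"]) auto
        then show False using x by blast
      qed
      then show "x \<in> {x. \<forall>s. 0 \<le> s \<and> s < t \<longrightarrow> norm (x + g s) < 1}" by blast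
    qed
    then show ?thesis using E by auto
  qed
  then have fin: "{x. ennreal t \<le> escape_time g x} \<in> sets borel" for t
    by (simp add: le_escape_time_iff)
  show "{x \<in> space borel. y \<le> escape_time g x} \<in> sets borel"
  proof (cases y)
    case (real t)
    then show ?thesis using fin by simp
  next
    case top
    \<comment> \<open>The level infinity is reached through countably many finite levels.\<close>
    have "{x. top \<le> escape_time g x} = (\<Inter>n. {x. ennreal (real n) \<le> escape_time g x})"
    proof (intro set_eqI iffI)
      fix x assume x: "x \<in> (\<Inter>n. {x. ennreal (real n) \<le> escape_time g x})"
      then have "\<not> escape_time g x < of_nat n" for n
        by (auto simp: ennreal_of_nat_eq_real_of_nat not_less)
      then show "x \<in> {x. top \<le> escape_time g x}"
        using ennreal_Ex_less_of_nat[of "escape_time g x"] less_top[of "escape_time g x"]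
        by (metis mem_Collect_eq order_refl)
    qed (auto simp: top_unique)
    also have "\<dots> \<in> sets borel" using fin by (intro sets.countable_INT) auto
    finally show ?thesis using top by simp
  qed
qed

text \<open>Each value y, infinity included, is the length of the set of positive reals up to y;
  Tonelli then exchanges the two integrals.\<close>

lemma (in sigma_finite_measure) nn_integral_layer_cake:
  assumes [measurable]: "f \<in> borel_measurable M"
  shows "(\<integral>\<^sup>+x. f x \<partial>M) = (\<integral>\<^sup>+t. emeasure M {x \<in> space M. ennreal t \<le> f x} * indicator {0<..} t \<partial>lborel)"
proof -
  interpret pair_sigma_finite M lborel ..
  have layer: "y = (\<integral>\<^sup>+t. indicator {t. 0 < t \<and> ennreal t \<le> y} t \<partial>lborel)" for y
  proof (cases y)
    case (real r)
    then have "{t. 0 < t \<and> ennreal t \<le> y} = {0<..r}" by (auto simp: ennreal_le_iff2)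
    then show ?thesis using real by simp
  next
    case top
    then have "{t. 0 < t \<and> ennreal t \<le> y} = {0<..}" by auto
    moreover have "emeasure lborel {0::real<..} = \<infinity>"
    proof -
      have "ennreal (real n) \<le> emeasure lborel {0::real<..}" for n
      proof -
        have "emeasure lborel {0<..real n} \<le> emeasure lborel {0::real<..}"
          by (intro emeasure_mono) auto
        then show ?thesis by simp
      qed
      then show ?thesis
        using ennreal_Ex_less_of_nat[of "emeasure lborel {0::real<..}"]
        by (metis ennreal_of_nat_eq_real_of_nat infinity_ennreal_def less_top not_less)
    qed
    ultimately show ?thesis using top by simp
  qed
  have "(\<integral>\<^sup>+x. f x \<partial>M) = (\<integral>\<^sup>+x. \<integral>\<^sup>+t. indicator {t. 0 < t \<and> ennreal t \<le> f x} t \<partial>lborel \<partial>M)"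
    by (intro nn_integral_cong layer)
  also have "\<dots> = (\<integral>\<^sup>+t. \<integral>\<^sup>+x. indicator {t. 0 < t \<and> ennreal t \<le> f x} t \<partial>M \<partial>lborel)"
    by (rule Fubini'[of "\<lambda>x t. indicator {t. 0 < t \<and> ennreal t \<le> f x} t", symmetric])
      (simp add: indicator_def)
  also have "\<dots> = (\<integral>\<^sup>+t. emeasure M {x \<in> space M. ennreal t \<le> f x} * indicator {0<..} t \<partial>lborel)"
  proof (intro nn_integral_cong)
    fix t :: real
    have "(\<integral>\<^sup>+x. indicator {t. 0 < t \<and> ennreal t \<le> f x} t \<partial>M)
        = (\<integral>\<^sup>+x. indicator {0<..} t * indicator {x \<in> space M. ennreal t \<le> f x} x \<partial>M)"
      by (intro nn_integral_cong) (auto simp: indicator_def)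
    then show "(\<integral>\<^sup>+x. indicator {t. 0 < t \<and> ennreal t \<le> f x} t \<partial>M)
        = emeasure M {x \<in> space M. ennreal t \<le> f x} * indicator {0<..} t"
      by (simp add: nn_integral_cmult_indicator mult.commute)
  qed
  finally show ?thesis .
qed

section \<open>Comparison of the superlevel sets\<close>

text \<open>Survival concerns open disks, the area bound closed ones. Interior points of the closed
  intersection \<open>K\<close> survive, and no area is lost because a convex set has a null
  frontier.\<close>

lemma emeasure_le_escape_time:
  fixes g :: "real \<Rightarrow> real^2"
  assumes g: "arclength_path g" and t: "0 < t" "t \<le> 2"
  shows "ennreal (lens_area (t / 2)) \<le> emeasure lborel {x. ennreal t \<le> escape_time g x}"
proof -
  define K where "K = (\<Inter>s\<in>{0..t}. cball (- g s) 1)"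
  have cont: "continuous_on {0..} g" using g by (simp add: arclength_path_def)
  have "bounded K" unfolding K_def
    using t by (intro bounded_subset[OF bounded_cball, of _ "- g 0" 1]) auto
  have "convex K" unfolding K_def by (intro convex_INT) auto
  have "closed K" unfolding K_def by (intro closed_INT) auto
  have Kfin: "emeasure lborel K = ennreal (measure lborel K)"
    using emeasure_bounded_finite[OF \<open>bounded K\<close>] by (intro emeasure_eq_ennreal_measure) auto
  have "lens_area (t / 2) \<le> measure lborel K"
    unfolding K_def using t arclength_path_dist_le[OF g] by (intro path_measure_Inter_cball) auto
  then have "ennreal (lens_area (t / 2)) \<le> emeasure lborel K" by (simp add: Kfin ennreal_leI)
  also have "\<dots> = emeasure lborel (interior K)"
  proof (rule emeasure_eq_AE)
    have "frontier K \<in> null_sets lebesgue"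
      using negligible_convex_frontier[OF \<open>convex K\<close>] by (simp add: negligible_iff_null_sets)
    then have "frontier K \<in> null_sets lborel"
      by (simp add: null_sets_completion_iff borel_closed)
    then show "AE x in lborel. x \<in> K \<longleftrightarrow> x \<in> interior K"
      by (rule AE_I') (use \<open>closed K\<close> in \<open>auto simp: frontier_def interior_subset[THEN subsetD]\<close>)
  qed (use \<open>closed K\<close> in auto)
  also have "\<dots> \<le> emeasure lborel {x. ennreal t \<le> escape_time g x}"
  proof (rule emeasure_mono)
    have "norm (x + g s) < 1" if "x \<in> interior K" "0 \<le> s" "s < t" for x s
    proof -
      have "K \<subseteq> cball (- g s) 1" using that by (auto simp: K_def)
      then have "x \<in> interior (cball (- g s) 1)" using that interior_mono by blast
      then show ?thesis by (simp add: interior_cball dist_norm norm_minus_commute)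
    qed
    then show "interior K \<subseteq> {x. ennreal t \<le> escape_time g x}"
      by (auto simp: le_escape_time_iff)
    show "{x. ennreal t \<le> escape_time g x} \<in> sets lborel"
      using escape_time_measurable[OF cont] by simp
  qed
  finally show ?thesis .
qed

text \<open>The closed disks for times 0 and \<open>t\<close> alone already give the lens as an
  upper bound; for \<open>t > 2\<close> they are disjoint.\<close>

lemma emeasure_le_escape_time_line:
  fixes u :: "real^2"
  assumes u: "norm u = 1" and t: "0 < t"
  shows "emeasure lborel {x. ennreal t \<le> escape_time (\<lambda>s. s *\<^sub>R u) x}
    \<le> (if t \<le> 2 then ennreal (lens_area (t / 2)) else 0)"
proof -
  let ?A = "{x. ennreal t \<le> escape_time (\<lambda>s. s *\<^sub>R u) x}"
  have sub: "norm x \<le> 1 \<and> norm (x + t *\<^sub>R u) \<le> 1" if "x \<in> ?A" for x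
  proof -
    have *: "norm (x + s *\<^sub>R u) < 1" if "0 \<le> s" "s < t" for s
      using \<open>x \<in> ?A\<close> that by (simp add: le_escape_time_iff)
    \<comment> \<open>Survival is known only before \<open>t\<close>; the limit from the left gives
      the closed condition at \<open>t\<close>.\<close>
    have "((\<lambda>s. norm (x + s *\<^sub>R u)) \<longlongrightarrow> norm (x + t *\<^sub>R u)) (at_left t)"
      by (intro tendsto_intros)
    moreover have "eventually (\<lambda>s. norm (x + s *\<^sub>R u) \<le> 1) (at_left t)"
      unfolding eventually_at_left_field using * t by (intro exI[of _ 0]) (auto intro: less_imp_le)
    ultimately have "norm (x + t *\<^sub>R u) \<le> 1"
      by (intro tendsto_upperbound) auto
    then show ?thesis using *[of 0] t by simp
  qed
  show ?thesis
  proof (cases "t \<le> 2")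
    case True
    have "?A \<subseteq> cball 0 1 \<inter> cball (- t *\<^sub>R u) 1"
      using sub by (auto simp: dist_norm norm_minus_commute add.commute)
    then have "emeasure lborel ?A \<le> emeasure lborel (cball 0 1 \<inter> cball (- t *\<^sub>R u) 1)"
      by (intro emeasure_mono) auto
    also have "\<dots> = ennreal (measure lborel (cball 0 1 \<inter> cball (- t *\<^sub>R u) 1))"
      using emeasure_bounded_finite[of "cball 0 1 \<inter> cball (- t *\<^sub>R u) 1"]
      by (intro emeasure_eq_ennreal_measure) (auto simp: bounded_Int)
    also have "\<dots> = ennreal (lens_area (t / 2))"
      using u t by (subst measure_cball_Int) auto
    finally show ?thesis using True by simp
  next
    case False
    have "x \<notin> ?A" for x
    proof
      assume "x \<in> ?A"
      from sub[OF this] have "norm (t *\<^sub>R u) \<le> 2"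
        using norm_triangle_ineq4[of "x + t *\<^sub>R u" x] by simp
      then show False using False u by simp
    qed
    then have "?A = {}" by blast
    then show ?thesis by simp
  qed
qed

theorem theorem1:
  fixes \<gamma> :: "real \<Rightarrow> real^2" and u :: "real^2"
  assumes "arclength_path \<gamma>"
    and "norm u = 1"
  shows "expected_escape \<gamma> \<ge> expected_escape (\<lambda>s. s *\<^sub>R u)"
proof -
  let ?M = "uniform_measure lborel unit_disk"
  have disk: "emeasure lborel unit_disk \<noteq> 0" "emeasure lborel unit_disk \<noteq> \<infinity>"
    using emeasure_bounded_finite[of unit_disk] content_cball_pos[of 1 "0 :: real^2"]
    by (auto simp: unit_disk_def measure_def)
  have [measurable, simp]: "unit_disk \<in> sets borel" by (simp add: unit_disk_def)
  interpret M: finite_measure ?M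
    using disk by (intro finite_measureI) (simp add: ennreal_divide_eq_top_iff)
  \<comment> \<open>Under the uniform measure each level becomes a normalised area, so it suffices
    to compare areas for every \<open>t > 0\<close>.\<close>
  have cake: "expected_escape g =
      (\<integral>\<^sup>+t. emeasure lborel (unit_disk \<inter> {x. ennreal t \<le> escape_time g x}) / emeasure lborel unit_disk
         * indicator {0<..} t \<partial>lborel)"
    if "continuous_on {0..} g" for g
  proof -
    have [measurable]: "escape_time g \<in> borel_measurable borel" by (rule escape_time_measurable[OF that])
    then show ?thesis unfolding expected_escape_def by (subst M.nn_integral_layer_cake) auto
  qed
  have "emeasure lborel (unit_disk \<inter> {x. ennreal t \<le> escape_time (\<lambda>s. s *\<^sub>R u) x})
      \<le> emeasure lborel (unit_disk \<inter> {x. ennreal t \<le> escape_time \<gamma> x})" if t: "0 < t" for t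
  proof -
    \<comment> \<open>Survival at time 0 already places the starting point in the disk.\<close>
    have "unit_disk \<inter> {x. ennreal t \<le> escape_time g x} = {x. ennreal t \<le> escape_time g x}"
      if "g 0 = 0" for g
    proof -
      have "x \<in> unit_disk" if "ennreal t \<le> escape_time g x" for x
        using t that[unfolded le_escape_time_iff, rule_format, of 0] \<open>g 0 = 0\<close>
        by (simp add: unit_disk_def)
      then show ?thesis by blast
    qed
    then have "unit_disk \<inter> {x. ennreal t \<le> escape_time \<gamma> x} = {x. ennreal t \<le> escape_time \<gamma> x}"
      "unit_disk \<inter> {x. ennreal t \<le> escape_time (\<lambda>s. s *\<^sub>R u) x} = {x. ennreal t \<le> escape_time (\<lambda>s. s *\<^sub>R u) x}"
      using assms(1) by (simp_all add: arclength_path_def)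
    \<comment> \<open>Up to \<open>t = 2\<close> the same lens area separates the two sides; beyond
      that the line's side is 0.\<close>
    then show ?thesis
      using emeasure_le_escape_time[OF assms(1) t] emeasure_le_escape_time_line[OF assms(2) t]
      by (auto split: if_splits intro: order_trans)
  qed
  then have "emeasure lborel (unit_disk \<inter> {x. ennreal t \<le> escape_time (\<lambda>s. s *\<^sub>R u) x}) / emeasure lborel unit_disk
        * indicator {0<..} t
      \<le> emeasure lborel (unit_disk \<inter> {x. ennreal t \<le> escape_time \<gamma> x}) / emeasure lborel unit_disk
        * indicator {0<..} t" for t :: real
    by (auto simp: indicator_def intro!: divide_right_mono_ennreal)
  moreover have "continuous_on {0..} \<gamma>" using assms(1) by (simp add: arclength_path_def)
  moreover have "continuous_on {0..} (\<lambda>s. s *\<^sub>R u)" by (intro continuous_intros)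
  ultimately show ?thesis by (auto simp: cake intro!: nn_integral_mono)
qed

end
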